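(* Let $w_1, w_2, d \in \mathbb{N}$, let $\chi$ be a Dirichlet character with conductor $d$, and let $\ell \in \mathbb{Z}_{+}$. Then, for all $x$ (equivalently, as an identity of polynomials in $x$), $$\sum_{i=0}^{\ell}\binom{\ell}{i}B_{i,\chi}(w_{2}x)\,T_{\ell-i}(\chi,dw_{1}-1)\,w_{1}^{i-1}w_{2}^{\ell-i}=\sum_{i=0}^{\ell}\binom{\ell}{i}B_{i,\chi}(w_{1}x)\,T_{\ell-i}(\chi,dw_{2}-1)\,w_{2}^{i-1}w_{1}^{\ell-i}.$$
   Context: $\mathbb{N}$ is the set of positive integers and $\mathbb{Z}_{+}=\mathbb{N}\cup\{0\}$. Let $p$ be a fixed prime and $\mathbb{C}_p$ the completion of an algebraic closure of $\mathbb{Q}_p$. A Dirichlet character $\chi$ with conductor $d$ is a primitive Dirichlet character modulo $d$, viewed as a $d$-periodic function on $\mathbb{Z}$ with $\chi(a)=0$ when $\gcd(a,d)>1$ (for $d=1$, $\chi$ is identically $1$, including $\chi(0)=1$); its values are regarded as elements of $\mathbb{C}_p$, and $x$ ranges over $\mathbb{C}_p$. The generalized Bernoulli polynomials $B_{n,\chi}(x)$ attached to $\chi$ are defined by the formal power series identity in $t$ $$\frac{t\sum_{i=0}^{d-1}\chi(i)e^{it}}{e^{dt}-1}\,e^{xt}=\sum_{n=0}^{\infty}B_{n,\chi}(x)\frac{t^{n}}{n!}.$$ For $k,n\in\mathbb{Z}_{+}$ define the power sum $T_k(\chi,n)=\sum_{j=0}^{n}\chi(j)\,j^{k}$, with the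 convention $0^0=1$. *)

theory Defs
  imports
    "HOL-Analysis.Abstract_Metric_Spaces"
    "HOL-Computational_Algebra.Computational_Algebra"
begin

locale ultrametric_field =
  fixes v :: "'a::field_char_0 \<Rightarrow> real"
  assumes v_nonneg: "0 \<le> v x"
    and v_eq_0_iff: "v x = 0 \<longleftrightarrow> x = 0"
    and v_mult: "v (x * y) = v x * v y"
    and v_add_le_max: "v (x + y) \<le> max (v x) (v y)"
begin

lemma v_1: "v 1 = 1"
  using v_mult[of 1 1] v_eq_0_iff[of 1] by simp

lemma v_minus: "v (- x) = v x"
proof -
  have "(v (-1))\<^sup>2 = 1"
    using v_mult[of "-1" "-1"] by (simp add: power2_eq_square v_1)
  then have "v (-1) = 1"
    using v_nonneg[of "-1"] by (simp add: power2_eq_1_iff)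
  then show ?thesis
    using v_mult[of "-1" x] by simp
qed

sublocale Metric_space UNIV "\<lambda>x y. v (x - y)"
proof
  fix x y z :: 'a
  show "0 \<le> v (x - y)"
    by (rule v_nonneg)
  show "v (x - y) = v (y - x)"
    using v_minus[of "x - y"] by simp
  show "v (x - y) = 0 \<longleftrightarrow> x = y"
    by (simp add: v_eq_0_iff)
  show "v (x - z) \<le> v (x - y) + v (y - z)"
    using v_add_le_max[of "x - y" "y - z"] v_nonneg[of "x - y"] v_nonneg[of "y - z"] by simp
qed

definition rat_closure :: "'a set"
  where "rat_closure = mtopology closure_of \<rat>"

definition algebraic_over_rat_closure :: "'a set"
  where "algebraic_over_rat_closure =
    {a. \<exists>f. f \<noteq> 0 \<and> (\<forall>i. coeff f i \<in> rat_closure) \<and> poly f a = 0}"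

end

text \<open>
  The field \<open>\<complex>\<^sub>p\<close> is described up to isometric isomorphism: by \<open>v_p\<close>, the absolute value
  restricts to the usual \<open>p\<close>-adic one on \<open>\<rat>\<close>; by completeness, \<open>rat_closure\<close> is \<open>\<rat>\<^sub>p\<close>;
  by \<open>alg_closed\<close>, the set \<open>algebraic_over_rat_closure\<close> is an algebraic closure of \<open>\<rat>\<^sub>p\<close>;
  and by density and completeness the whole type is the completion of that closure.
\<close>

locale padic_complex_field = ultrametric_field v
  for p :: nat and v :: "'a::field_char_0 \<Rightarrow> real" +
  assumes prime_p: "prime p"
    and v_p: "v (of_nat p) = 1 / real p"
    and complete: "mcomplete"
    and alg_closed: "\<lbrakk>degree f > 0; \<And>i. coeff f i \<in> algebraic_over_rat_closure\<rbrakk>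
      \<Longrightarrow> \<exists>a \<in> algebraic_over_rat_closure. poly f a = 0"
    and dense: "mtopology closure_of algebraic_over_rat_closure = UNIV"

definition dirichlet_character :: "nat \<Rightarrow> (int \<Rightarrow> 'a::field) \<Rightarrow> bool"
  where "dirichlet_character m chi \<longleftrightarrow>
    m > 0 \<and> chi 1 = 1 \<and>
    (\<forall>a b. chi (a * b) = chi a * chi b) \<and>
    (\<forall>a. chi (a + int m) = chi a) \<and>
    (\<forall>a. chi a = 0 \<longleftrightarrow> \<not> coprime a (int m))"

definition primitive_dirichlet_character :: "nat \<Rightarrow> (int \<Rightarrow> 'a::field) \<Rightarrow> bool"
  where "primitive_dirichlet_character d chi \<longleftrightarrow>
    dirichlet_character d chi \<and>
    \<not> (\<exists>m psi. m dvd d \<and> m < d \<and> dirichlet_character m psi \<and>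
          (\<forall>a. coprime a (int d) \<longrightarrow> chi a = psi a))"

definition gen_bernoulli_egf ::
    "nat \<Rightarrow> (int \<Rightarrow> 'a::field_char_0) \<Rightarrow> 'a \<Rightarrow> 'a fps"
  where "gen_bernoulli_egf d chi x =
    fps_X * (\<Sum>i = 0..d - 1. fps_const (chi (int i)) * fps_exp (of_nat i))
      / (fps_exp (of_nat d) - 1) * fps_exp x"

definition gen_bernpoly ::
    "nat \<Rightarrow> (int \<Rightarrow> 'a::field_char_0) \<Rightarrow> nat \<Rightarrow> 'a \<Rightarrow> 'a"
  where "gen_bernpoly d chi n x = fact n * fps_nth (gen_bernoulli_egf d chi x) n"

text \<open>
  Division of formal power series truncates in general; here it is exact because the
  denominator has subdegree 1.
\<close>

lemma gen_bernoulli_egf_exact: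
  fixes x :: "'a::field_char_0"
  assumes "d > 0"
  shows "gen_bernoulli_egf d chi x * (fps_exp (of_nat d) - 1) =
    fps_X * (\<Sum>i = 0..d - 1. fps_const (chi (int i)) * fps_exp (of_nat i)) * fps_exp x"
proof -
  let ?g = "fps_exp (of_nat d :: 'a) - 1"
  let ?f = "fps_X * (\<Sum>i = 0..d - 1. fps_const (chi (int i)) * fps_exp (of_nat i))"
  have g: "subdegree ?g = 1"
    using assms by (intro subdegreeI) auto
  then have "?g \<noteq> 0"
    by (metis subdegree_0 zero_neq_one)
  moreover have "?g dvd ?f"
  proof (cases "?f = 0")
    case False
    then have "1 \<le> subdegree ?f"
      by (intro subdegree_geI) auto
    then show ?thesis
      unfolding fps_dvd_iff[OF \<open>?g \<noteq> 0\<close> False] g .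
  qed simp
  then have "?f / ?g * ?g = ?f"
    by (rule dvd_div_mult_self)
  then show ?thesis
    unfolding gen_bernoulli_egf_def
    by (simp only: mult.assoc [of _ _ ?g] mult.commute [of "fps_exp x" ?g])
      (simp only: mult.assoc [symmetric])
qed

definition char_power_sum :: "nat \<Rightarrow> (int \<Rightarrow> 'a::field) \<Rightarrow> nat \<Rightarrow> 'a"
  where "char_power_sum k chi n = (\<Sum>j = 0..n. chi (int j) * of_nat j ^ k)"

end

theory Submission
  imports Defs
begin

text \<open>
  Let \<open>S(t) = \<Sum>\<^sub>i\<^sub><\<^sub>d \<chi>(i) e\<^sup>i\<^sup>t\<close>. Up to the factor \<open>l!\<close>, the left-hand side is the
  coefficient of \<open>t\<^sup>l\<close> in \<open>w\<^sub>1\<inverse> B(w\<^sub>1 t) T(w\<^sub>2 t)\<close>, where \<open>B\<close> is the exponential generating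
  function of the \<open>B\<^sub>n\<^sub>,\<^sub>\<chi>(w\<^sub>2 x)\<close> and \<open>T\<close> that of the power sums up to \<open>d w\<^sub>1 - 1\<close>.
  Since \<open>\<chi>\<close> has period \<open>d\<close>, the sum of exponentials \<open>T\<close> is a geometric progression of copies
  of \<open>S\<close>, so \<open>T(t) = S(t) (e^(d w\<^sub>1 t) - 1) / (e^(d t) - 1)\<close>
  (\<open>twisted_exp_sum_periodic\<close>). Hence the product is
  \<open>t S(w\<^sub>1 t) S(w\<^sub>2 t) e^(w\<^sub>1 w\<^sub>2 x t) (e^(d w\<^sub>1 w\<^sub>2 t) - 1) / ((e^(d w\<^sub>1 t) - 1) (e^(d w\<^sub>2 t) - 1))\<close>,
  which does not change when \<open>w\<^sub>1\<close> and \<open>w\<^sub>2\<close> are exchanged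
  (\<open>bernoulli_power_sum_egf_symmetric\<close>); comparing coefficients gives the theorem.
\<close>

definition fps_rescale :: "'a::comm_ring_1 \<Rightarrow> 'a fps \<Rightarrow> 'a fps"
  where "fps_rescale c F = F oo (fps_const c * fps_X)"

lemma fps_rescale_nth: "fps_nth (fps_rescale c F) n = c ^ n * fps_nth F n"
  by (simp add: fps_rescale_def)

lemma fps_rescale_mult:
  fixes F G :: "'a::idom fps"
  shows "fps_rescale c (F * G) = fps_rescale c F * fps_rescale c G"
  by (simp add: fps_rescale_def fps_compose_mult_distrib)

lemma fps_rescale_X: "fps_rescale c fps_X = fps_const c * fps_X"
  by (simp add: fps_rescale_def)

lemma fps_rescale_exp:
  fixes a c :: "'a::field_char_0"
  shows "fps_rescale c (fps_exp a) = fps_exp (c * a)"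
  by (simp add: fps_eq_iff fps_rescale_nth power_mult_distrib)

lemma fps_rescale_exp_minus_1:
  fixes a c :: "'a::field_char_0"
  shows "fps_rescale c (fps_exp a - 1) = fps_exp (c * a) - 1"
  using fps_rescale_exp[of c a] by (simp add: fps_rescale_def fps_compose_sub_distrib)

lemma fps_exp_minus_1_nonzero:
  fixes c :: "'a::field_char_0"
  assumes "c \<noteq> 0"
  shows "fps_exp c - 1 \<noteq> 0"
proof
  assume "fps_exp c - 1 = 0"
  then have "fps_nth (fps_exp c - 1) 1 = 0"
    by simp
  with assms show False
    by simp
qed

definition twisted_exp_sum :: "nat \<Rightarrow> (int \<Rightarrow> 'a::field_char_0) \<Rightarrow> 'a fps"
  where "twisted_exp_sum n chi = (\<Sum>j<n. fps_const (chi (int j)) * fps_exp (of_nat j))"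

lemma fact_mult_nth_twisted_exp_sum:
  assumes "n > 0"
  shows "fact k * fps_nth (twisted_exp_sum n chi) k = char_power_sum k chi (n - 1)"
proof -
  have "{..<n} = {0..n - 1}"
    using assms by auto
  then show ?thesis
    by (simp add: twisted_exp_sum_def char_power_sum_def fps_sum_nth sum_distrib_left)
qed

lemma gen_bernoulli_egf_twisted_exp_sum:
  assumes "d > 0"
  shows "gen_bernoulli_egf d chi x * (fps_exp (of_nat d) - 1)
    = fps_X * twisted_exp_sum d chi * fps_exp x"
proof -
  have "{..<d} = {0..d - 1}"
    using assms by auto
  then show ?thesis
    unfolding twisted_exp_sum_def by (simp only: gen_bernoulli_egf_exact[OF assms])
qed

text \<open>
  By periodicity, the terms with \<open>d w \<le> j < d (w + 1)\<close> add up to \<open>e^(d w t)\<close> times the sum over the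
  first period, so the product with \<open>e^(d t) - 1\<close> telescopes.
\<close>

lemma twisted_exp_sum_periodic:
  fixes chi :: "int \<Rightarrow> 'a::field_char_0"
  assumes periodic: "\<And>a. chi (a + int d) = chi a"
  shows "twisted_exp_sum (d * w) chi * (fps_exp (of_nat d) - 1)
    = twisted_exp_sum d chi * (fps_exp (of_nat (d * w)) - 1)"
proof (induction w)
  case 0
  show ?case
    by (simp add: twisted_exp_sum_def)
next
  case (Suc w)
  have shift: "chi (int (d * w + j)) = chi (int j)" for j
  proof (induction w)
    case (Suc w)
    have "int (d * Suc w + j) = int (d * w + j) + int d"
      by simp
    then show ?case
      using Suc periodic by metis
  qed simp
  have split: "(\<Sum>j<m + n. f j) = (\<Sum>j<m. f j) + (\<Sum>j<n. f (m + j))"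
    for f :: "nat \<Rightarrow> 'a fps" and m n
    by (induction n) (simp_all add: add.assoc)
  have "twisted_exp_sum (d * Suc w) chi = twisted_exp_sum (d * w) chi
      + (\<Sum>j<d. fps_const (chi (int (d * w + j))) * fps_exp (of_nat (d * w + j)))"
    unfolding twisted_exp_sum_def mult_Suc_right add.commute[of d] by (rule split)
  also have "(\<Sum>j<d. fps_const (chi (int (d * w + j))) * fps_exp (of_nat (d * w + j)))
      = fps_exp (of_nat (d * w)) * twisted_exp_sum d chi"
    unfolding shift
    unfolding twisted_exp_sum_def sum_distrib_left of_nat_add fps_exp_add_mult
    by (simp only: mult_ac)
  finally have step: "twisted_exp_sum (d * Suc w) chi
      = twisted_exp_sum (d * w) chi + fps_exp (of_nat (d * w)) * twisted_exp_sum d chi" .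
  have "fps_exp (of_nat (d * Suc w) :: 'a) = fps_exp (of_nat (d * w)) * fps_exp (of_nat d)"
    by (simp only: mult_Suc_right add.commute[of d] of_nat_add fps_exp_add_mult)
  then show ?case
    unfolding step distrib_right Suc by (simp add: algebra_simps)
qed

definition bernoulli_power_sum_egf ::
    "nat \<Rightarrow> (int \<Rightarrow> 'a::field_char_0) \<Rightarrow> 'a \<Rightarrow> nat \<Rightarrow> nat \<Rightarrow> 'a fps"
  where "bernoulli_power_sum_egf d chi x w1 w2 =
    fps_const (inverse (of_nat w1))
      * fps_rescale (of_nat w1) (gen_bernoulli_egf d chi (of_nat w2 * x))
      * fps_rescale (of_nat w2) (twisted_exp_sum (d * w1) chi)"

text \<open>
  The denominators \<open>e^(d w t) - 1\<close> have zero constant term and no inverse among formal power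
  series, so the closed form of the product is stated with denominators cleared; being nonzero,
  they can be cancelled afterwards. The factor \<open>w\<^sub>1\<close> from rescaling the leading \<open>t\<close> of \<open>B\<close>
  absorbs \<open>w\<^sub>1\<inverse>\<close>, which is why the theorem has the exponent \<open>i - 1\<close>.
\<close>

lemma bernoulli_power_sum_egf_cleared:
  fixes chi :: "int \<Rightarrow> 'a::field_char_0"
  assumes "d > 0" "w1 > 0"
    and periodic: "\<And>a. chi (a + int d) = chi a"
  shows "bernoulli_power_sum_egf d chi x w1 w2
      * ((fps_exp (of_nat (d * w1)) - 1) * (fps_exp (of_nat (d * w2)) - 1))
    = fps_X * fps_rescale (of_nat w1) (twisted_exp_sum d chi)
      * fps_rescale (of_nat w2) (twisted_exp_sum d chi)
      * fps_exp (of_nat (w1 * w2) * x) * (fps_exp (of_nat (d * w1 * w2)) - 1)"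
proof -
  let ?R1 = "fps_rescale (of_nat w1 :: 'a)" and ?R2 = "fps_rescale (of_nat w2 :: 'a)"
  let ?B = "gen_bernoulli_egf d chi (of_nat w2 * x)"
  let ?S = "twisted_exp_sum d chi"
  let ?T = "twisted_exp_sum (d * w1) chi"
  have "?R1 (?B * (fps_exp (of_nat d) - 1)) = ?R1 (fps_X * ?S * fps_exp (of_nat w2 * x))"
    by (simp only: gen_bernoulli_egf_twisted_exp_sum[OF \<open>d > 0\<close>])
  then have B: "?R1 ?B * (fps_exp (of_nat (d * w1)) - 1)
      = fps_const (of_nat w1) * fps_X * ?R1 ?S * fps_exp (of_nat (w1 * w2) * x)"
    by (simp add: fps_rescale_mult fps_rescale_X fps_rescale_exp fps_rescale_exp_minus_1 mult_ac)
  have "?R2 (?T * (fps_exp (of_nat d) - 1)) = ?R2 (?S * (fps_exp (of_nat (d * w1)) - 1))"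
    by (simp only: twisted_exp_sum_periodic[of chi, OF periodic])
  then have T: "?R2 ?T * (fps_exp (of_nat (d * w2)) - 1)
      = ?R2 ?S * (fps_exp (of_nat (d * w1 * w2)) - 1)"
    by (simp add: fps_rescale_mult fps_rescale_X fps_rescale_exp fps_rescale_exp_minus_1 mult_ac)
  have unit: "fps_const (inverse (of_nat w1)) * fps_const (of_nat w1 :: 'a) = 1"
    using \<open>w1 > 0\<close> by simp
  have "bernoulli_power_sum_egf d chi x w1 w2
      * ((fps_exp (of_nat (d * w1)) - 1) * (fps_exp (of_nat (d * w2)) - 1))
    = fps_const (inverse (of_nat w1)) * (?R1 ?B * (fps_exp (of_nat (d * w1)) - 1))
      * (?R2 ?T * (fps_exp (of_nat (d * w2)) - 1))"
    unfolding bernoulli_power_sum_egf_def by (simp only: mult_ac)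
  also have "\<dots> = (fps_const (inverse (of_nat w1)) * fps_const (of_nat w1))
      * (fps_X * ?R1 ?S * ?R2 ?S
      * fps_exp (of_nat (w1 * w2) * x) * (fps_exp (of_nat (d * w1 * w2)) - 1))"
    unfolding B T by (simp only: mult_ac)
  finally show ?thesis
    unfolding unit by simp
qed

lemma bernoulli_power_sum_egf_symmetric:
  fixes chi :: "int \<Rightarrow> 'a::field_char_0"
  assumes "d > 0" "w1 > 0" "w2 > 0"
    and periodic: "\<And>a. chi (a + int d) = chi a"
  shows "bernoulli_power_sum_egf d chi x w1 w2 = bernoulli_power_sum_egf d chi x w2 w1"
proof -
  let ?D = "(fps_exp (of_nat (d * w1)) - 1) * (fps_exp (of_nat (d * w2)) - 1) :: 'a fps"
  have "of_nat (d * w1) \<noteq> (0 :: 'a)" "of_nat (d * w2) \<noteq> (0 :: 'a)"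
    using assms by simp_all
  then have "?D \<noteq> 0"
    by (simp only: mult_eq_0_iff fps_exp_minus_1_nonzero simp_thms)
  moreover have "bernoulli_power_sum_egf d chi x w1 w2 * ?D
      = bernoulli_power_sum_egf d chi x w2 w1 * ?D"
    using bernoulli_power_sum_egf_cleared[of d w1 chi x w2]
      bernoulli_power_sum_egf_cleared[of d w2 chi x w1] assms
    by (simp only: mult_ac)
  ultimately show ?thesis
    by simp
qed

text \<open>
  The binomial coefficients arise from the Cauchy product of two exponential generating
  functions; rescaling by \<open>w\<^sub>1\<close> and \<open>w\<^sub>2\<close> supplies the powers.
\<close>

lemma fact_mult_nth_bernoulli_power_sum_egf:
  fixes chi :: "int \<Rightarrow> 'a::field_char_0"
  assumes "d > 0" "w1 > 0"
  shows "fact l * fps_nth (bernoulli_power_sum_egf d chi x w1 w2) l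
    = (\<Sum>i = 0..l. of_nat (l choose i) * gen_bernpoly d chi i (of_nat w2 * x)
        * char_power_sum (l - i) chi (d * w1 - 1)
        * of_nat w1 powi (int i - 1) * of_nat w2 ^ (l - i))"
proof -
  let ?b = "fps_nth (gen_bernoulli_egf d chi (of_nat w2 * x))"
  let ?t = "fps_nth (twisted_exp_sum (d * w1) chi)"
  have "fact l * fps_nth (bernoulli_power_sum_egf d chi x w1 w2) l
    = (\<Sum>i = 0..l. fact l * (inverse (of_nat w1) * (of_nat w1 ^ i * ?b i)
        * (of_nat w2 ^ (l - i) * ?t (l - i))))"
    unfolding bernoulli_power_sum_egf_def
    by (simp only: fps_mult_nth[of "fps_const _ * _"] fps_mult_left_const_nth
        fps_rescale_nth sum_distrib_left)
  also have "\<dots> = (\<Sum>i = 0..l. of_nat (l choose i) * gen_bernpoly d chi i (of_nat w2 * x)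
        * char_power_sum (l - i) chi (d * w1 - 1)
        * of_nat w1 powi (int i - 1) * of_nat w2 ^ (l - i))"
  proof (rule sum.cong)
    fix i
    assume "i \<in> {0..l}"
    then have fact: "fact l = of_nat (l choose i) * fact i * (fact (l - i) :: 'a)"
      by (simp add: binomial_fact)
    have t: "char_power_sum (l - i) chi (d * w1 - 1) = fact (l - i) * ?t (l - i)"
      using assms by (simp add: fact_mult_nth_twisted_exp_sum)
    have pow: "of_nat w1 powi (int i - 1) = inverse (of_nat w1) * (of_nat w1 :: 'a) ^ i"
      using assms by (simp add: power_int_diff field_simps)
    show "fact l * (inverse (of_nat w1) * (of_nat w1 ^ i * ?b i)
        * (of_nat w2 ^ (l - i) * ?t (l - i)))
      = of_nat (l choose i) * gen_bernpoly d chi i (of_nat w2 * x)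
        * char_power_sum (l - i) chi (d * w1 - 1)
        * of_nat w1 powi (int i - 1) * of_nat w2 ^ (l - i)"
      unfolding fact t pow gen_bernpoly_def by (simp only: mult_ac)
  qed simp
  finally show ?thesis .
qed

theorem theorem2:
  fixes p w1 w2 d l :: nat
    and v :: "'a::field_char_0 \<Rightarrow> real"
    and chi :: "int \<Rightarrow> 'a"
    and x :: 'a
  assumes "padic_complex_field p v"
    and "w1 \<ge> 1" and "w2 \<ge> 1" and "d \<ge> 1"
    and "primitive_dirichlet_character d chi"
  shows "(\<Sum>i = 0..l. of_nat (l choose i) * gen_bernpoly d chi i (of_nat w2 * x)
            * char_power_sum (l - i) chi (d * w1 - 1)
            * of_nat w1 powi (int i - 1) * of_nat w2 ^ (l - i))
       = (\<Sum>i = 0..l. of_nat (l choose i) * gen_bernpoly d chi i (of_nat w1 * x)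
            * char_power_sum (l - i) chi (d * w2 - 1)
            * of_nat w2 powi (int i - 1) * of_nat w1 ^ (l - i))"
proof -
  have pos: "d > 0" "w1 > 0" "w2 > 0"
    using assms by simp_all
  have periodic: "chi (a + int d) = chi a" for a
    using assms(5) by (simp add: primitive_dirichlet_character_def dirichlet_character_def)
  show ?thesis
    using bernoulli_power_sum_egf_symmetric[of d w1 w2 chi x, OF pos periodic]
      fact_mult_nth_bernoulli_power_sum_egf[of d w1 l chi x w2]
      fact_mult_nth_bernoulli_power_sum_egf[of d w2 l chi x w1] pos
    by simp
qed

end
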